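(* Let $a,b$ be real numbers with $0<a/2<b$. For all independent identically distributed real random variables $X,Y$, $$\mathbb{P}(|X+Y|\le b)<\lceil 2b/a\rceil\cdot \mathbb{P}(|X-Y|\le a).$$ Moreover, the constant $\lceil 2b/a\rceil$ cannot be improved: for all such $a,b$ and every real $c<\lceil 2b/a\rceil$ there exist independent identically distributed real random variables $X,Y$ with $\mathbb{P}(|X+Y|\le b)> c\cdot\mathbb{P}(|X-Y|\le a)$. When $0<b\le a/2$, the inequality holds with $\le$ in place of $<$, that is, $\mathbb{P}(|X+Y|\le b)\le \lceil 2b/a\rceil\cdot \mathbb{P}(|X-Y|\le a)$ for all independent identically distributed real random variables $X,Y$ (here $\lceil 2b/a\rceil=1$), and it is still tight: the constant cannot be replaced by any smaller one.
   Context: $\lceil t\rceil$ denotes the smallest integer greater than or equal to $t$. *)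

theory Defs
  imports "HOL-Probability.Probability"
begin

(* The predicate indep_var already includes that X and Y are random variables on M. *)
definition iid_pair :: "'w measure \<Rightarrow> ('w \<Rightarrow> real) \<Rightarrow> ('w \<Rightarrow> real) \<Rightarrow> bool" where
  "iid_pair M X Y \<longleftrightarrow>
     prob_space M \<and> prob_space.indep_var M borel X borel Y \<and> distr M borel X = distr M borel Y"

end

theory Submission imports Defs begin

text \<open>Let \<open>n = \<lceil>2 b / a\<rceil>\<close>. Among finitely many points choose one, \<open>p\<close>, with the maximal number \<open>t\<close> of points
  within distance \<open>a\<close>. A closed interval of length \<open>2 b\<close> is covered by \<open>n\<close> intervals of length \<open>a\<close>, each
  holding at most \<open>t\<close> points. Deleting \<open>p\<close> therefore lowers the number of ordered pairs with
  \<open>\<bar>x + y\<bar> \<le> b\<close> by at most \<open>2 n t\<close> and the number with \<open>\<bar>x - y\<bar> \<le> a\<close> by \<open>2 t - 1\<close>. By induction the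
  inequality holds for counts up to an error linear in the number of points, which disappears for a
  large i.i.d. sample.

  Strictness for \<open>n \<ge> 2\<close>: in the case of equality, almost every \<open>x\<close> satisfies
  \<open>n \<mu>[x - a, x + a] = \<mu>[- x - n a / 2, - x + n a / 2]\<close>. Let \<open>t\<close> be the largest mass of a closed
  interval of length \<open>a\<close>, let \<open>A\<close> consist of those \<open>x\<close> for which moreover \<open>\<mu>[x - a, x + a] = t\<close>, and let
  \<open>s = sup A\<close>. For \<open>x \<in> A\<close> the two half-open end tiles of the interval around \<open>- x\<close> have mass \<open>t\<close>, and
  almost all their points lie in \<open>A\<close>. Applying this twice gives \<open>\<mu>(- s, - x) \<ge> t > 0\<close>, which fails as
  \<open>x\<close> tends to \<open>s\<close>.\<close>

section \<open>Counting close pairs in finite families of points\<close>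

lemma atLeastAtMost_tiles:
  fixes u a :: real
  assumes "0 \<le> a" "0 < n"
  shows "{u..u + real n * a} \<subseteq> (\<Union>k<n. {u + real k * a..u + real k * a + a})"
  using \<open>0 < n\<close>
proof (induction n rule: nat_induct_non_zero)
  case 1
  show ?case using \<open>0 \<le> a\<close> by auto
next
  case (Suc n)
  have "{u..u + real (Suc n) * a} \<subseteq> {u..u + real n * a} \<union> {u + real n * a..u + real n * a + a}"
    by (auto simp: algebra_simps)
  also have "\<dots> \<subseteq> (\<Union>k<Suc n. {u + real k * a..u + real k * a + a})"
    using Suc.IH by (force simp: lessThan_Suc)
  finally show ?case .
qed

lemma card_vimage_cover_le:
  assumes "finite I" "A \<subseteq> (\<Union>k<n::nat. B k)"
  shows "card {j\<in>I. p j \<in> A} \<le> (\<Sum>k<n. card {j\<in>I. p j \<in> B k})"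
proof -
  have "card {j\<in>I. p j \<in> A} \<le> card (\<Union>k<n. {j\<in>I. p j \<in> B k})"
    using assms by (intro card_mono) auto
  also have "\<dots> \<le> (\<Sum>k<n. card {j\<in>I. p j \<in> B k})"
    by (rule card_UN_le) simp
  finally show ?thesis .
qed

lemma sum_of_bool_card:
  "finite I \<Longrightarrow> (\<Sum>y\<in>I. of_bool (P y)) = real (card {y\<in>I. P y})"
  by (simp add: Int_def)

text \<open>By symmetry the row and the column of \<open>i\<close> have the same sum, and they share
  exactly the diagonal entry, which is counted twice.\<close>

lemma sum_sum_insert:
  fixes K :: "'i \<Rightarrow> 'i \<Rightarrow> real"
  assumes "finite I" "i \<in> I" and sym: "\<And>x y. K x y = K y x"
  shows "(\<Sum>x\<in>I. \<Sum>y\<in>I. K x y)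
    = (\<Sum>x\<in>I - {i}. \<Sum>y\<in>I - {i}. K x y) + 2 * (\<Sum>y\<in>I. K i y) - K i i"
proof -
  have *: "(\<Sum>y\<in>I. g y) = g i + (\<Sum>y\<in>I - {i}. g y)" for g :: "'i \<Rightarrow> real"
    using assms by (simp add: sum.remove)
  have "(\<Sum>x\<in>I - {i}. K x i) = (\<Sum>y\<in>I - {i}. K i y)"
    by (simp add: sym)
  then show ?thesis
    by (simp add: * sum.distrib)
qed

text \<open>Removing a point costs up to \<open>2 n t\<close> on the left but only
  \<open>n (2 t - 1)\<close> in the main term on the right. The deficit of \<open>n\<close> per
  removed point accumulates to the additive error.\<close>

lemma card_sum_pairs_le:
  fixes p :: "'i \<Rightarrow> real"
  assumes "finite I" "0 < a" "0 < n" "2 * b \<le> real n * a"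
  shows "(\<Sum>i\<in>I. \<Sum>j\<in>I. of_bool (\<bar>p i + p j\<bar> \<le> b))
    \<le> real n * (\<Sum>i\<in>I. \<Sum>j\<in>I. of_bool (\<bar>p i - p j\<bar> \<le> a)) + real n * real (card I)"
  using \<open>finite I\<close>
proof (induction "card I" arbitrary: I)
  case 0
  then show ?case by simp
next
  case (Suc N)
  define t where "t i = card {j\<in>I. \<bar>p i - p j\<bar> \<le> a}" for i
  have "I \<noteq> {}" "finite I" using Suc by auto
  then have "Max (t ` I) \<in> t ` I" by simp
  then obtain i where "i \<in> I" "t i = Max (t ` I)" by force
  then have i: "i \<in> I" "\<And>j. j \<in> I \<Longrightarrow> t j \<le> t i"
    using \<open>finite I\<close> by auto
  \<comment> \<open>All points in a tile of length \<open>a\<close> are within \<open>a\<close> of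
    any one of them, so a nonempty tile holds at most \<open>t l\<close> points for some
    \<open>l\<close>, and \<open>t i\<close> is maximal.\<close>
  have tile: "card {j\<in>I. p j \<in> {v..v + a}} \<le> t i" for v
  proof (cases "{j\<in>I. p j \<in> {v..v + a}} = {}")
    case False
    then obtain l where l: "l \<in> I" "p l \<in> {v..v + a}" by auto
    have "card {j\<in>I. p j \<in> {v..v + a}} \<le> t l"
      unfolding t_def using l \<open>finite I\<close> by (intro card_mono) auto
    then show ?thesis using i(2)[OF l(1)] by simp
  qed (simp only: card.empty)
  \<comment> \<open>Left end of the interval of length \<open>n a\<close> centred at
    \<open>- p i\<close>; it contains the window of radius \<open>b\<close> because
    \<open>2 b \<le> n a\<close>.\<close>
  let ?u = "- p i - real n * a / 2"
  have "card {j\<in>I. \<bar>p i + p j\<bar> \<le> b} \<le> card {j\<in>I. p j \<in> {?u..?u + real n * a}}"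
    using assms(4) \<open>finite I\<close> by (intro card_mono) (auto simp: field_simps)
  also have "\<dots> \<le> (\<Sum>k<n. card {j\<in>I. p j \<in> {?u + real k * a..?u + real k * a + a}})"
    using \<open>0 < a\<close> by (intro card_vimage_cover_le atLeastAtMost_tiles \<open>finite I\<close> \<open>0 < n\<close>) simp
  also have "\<dots> \<le> (\<Sum>k<n. t i)"
    by (intro sum_mono tile)
  finally have g: "real (card {j\<in>I. \<bar>p i + p j\<bar> \<le> b}) \<le> real n * real (t i)"
    by (simp flip: of_nat_mult)
  \<comment> \<open>Here the diagonal entry is discarded, since it may be 0. In \<open>T\<close> it
    equals 1 because \<open>0 < a\<close>, and an exact count is kept.\<close>
  have S: "(\<Sum>x\<in>I. \<Sum>y\<in>I. of_bool (\<bar>p x + p y\<bar> \<le> b)) \<le>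
      (\<Sum>x\<in>I - {i}. \<Sum>y\<in>I - {i}. of_bool (\<bar>p x + p y\<bar> \<le> b)) + 2 * (real n * real (t i))"
    proof -
    have "(\<Sum>y\<in>I. of_bool (\<bar>p i + p y\<bar> \<le> b)) \<le> real n * real (t i)"
      using g unfolding sum_of_bool_card[OF \<open>finite I\<close>] .
    then show ?thesis
      by (subst sum_sum_insert[OF \<open>finite I\<close> i(1)]) (simp_all only: add.commute, simp)
  qed
  have T: "(\<Sum>x\<in>I. \<Sum>y\<in>I. of_bool (\<bar>p x - p y\<bar> \<le> a)) =
      (\<Sum>x\<in>I - {i}. \<Sum>y\<in>I - {i}. of_bool (\<bar>p x - p y\<bar> \<le> a)) + 2 * real (t i) - 1"
    proof -
    have "(\<Sum>y\<in>I. of_bool (\<bar>p i - p y\<bar> \<le> a)) = real (t i)"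
      unfolding t_def sum_of_bool_card[OF \<open>finite I\<close>] ..
    moreover have "of_bool (\<bar>p i - p i\<bar> \<le> a) = (1::real)"
      using \<open>0 < a\<close> by simp
    ultimately show ?thesis
      by (subst sum_sum_insert[OF \<open>finite I\<close> i(1)]) (simp_all only: abs_minus_commute)
  qed
  have c: "card I = Suc (card (I - {i}))"
    using Suc i by simp
  have "(\<Sum>x\<in>I - {i}. \<Sum>y\<in>I - {i}. of_bool (\<bar>p x + p y\<bar> \<le> b))
    \<le> real n * (\<Sum>x\<in>I - {i}. \<Sum>y\<in>I - {i}. of_bool (\<bar>p x - p y\<bar> \<le> a)) + real n * real (card (I - {i}))"
    using c Suc by (intro Suc) auto
  then show ?case
    using S unfolding T c by (simp only: of_nat_Suc) argo
qed

section \<open>Expected pair counts in an i.i.d. sample\<close>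

lemma distr_PiM_pair:
  assumes "prob_space \<mu>" "i \<in> I" "j \<in> I" "i \<noteq> j"
  shows "distr (\<Pi>\<^sub>M k\<in>I. \<mu>) (\<mu> \<Otimes>\<^sub>M \<mu>) (\<lambda>\<omega>. (\<omega> i, \<omega> j)) = \<mu> \<Otimes>\<^sub>M \<mu>"
proof (rule pair_measure_eqI[symmetric])
  interpret prob_space \<mu> by fact
  show "sigma_finite_measure \<mu>" "sigma_finite_measure \<mu>" by unfold_locales
  interpret P: product_prob_space "\<lambda>_. \<mu>" I by unfold_locales
  fix A B assume AB[measurable]: "A \<in> sets \<mu>" "B \<in> sets \<mu>"
  have "emeasure (distr (\<Pi>\<^sub>M k\<in>I. \<mu>) (\<mu> \<Otimes>\<^sub>M \<mu>) (\<lambda>\<omega>. (\<omega> i, \<omega> j))) (A \<times> B)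
    = emeasure (\<Pi>\<^sub>M k\<in>I. \<mu>) {\<omega>\<in>space (\<Pi>\<^sub>M k\<in>I. \<mu>). \<forall>k\<in>{i, j}. \<omega> k \<in> (if k = i then A else B)}"
    using assms by (subst emeasure_distr) (auto intro!: arg_cong2[where f=emeasure])
  also have "\<dots> = emeasure \<mu> A * emeasure \<mu> B"
    using assms by (subst P.emeasure_PiM_Collect) auto
  finally show "emeasure \<mu> A * emeasure \<mu> B =
    emeasure (distr (\<Pi>\<^sub>M k\<in>I. \<mu>) (\<mu> \<Otimes>\<^sub>M \<mu>) (\<lambda>\<omega>. (\<omega> i, \<omega> j))) (A \<times> B)" by simp
qed simp

text \<open>\<open>q\<close> lists \<open>N\<close> samples followed by \<open>m\<close> copies of \<open>x\<close>. The term \<open>E\<close> collects the pairs of distinct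
  samples and the mixed pairs; the error \<open>N + m\<^sup>2\<close> allows for the diagonal pairs of samples and the
  pairs of copies.\<close>

lemma expected_pairs:
  fixes \<mu> :: "real measure" and D :: "real \<Rightarrow> real \<Rightarrow> bool"
  assumes "prob_space \<mu>" and [measurable_cong]: "sets \<mu> = sets borel"
    and D: "{z. D (fst z) (snd z)} \<in> sets borel" and sym: "\<And>x y. D x y = D y x"
  defines "q \<equiv> \<lambda>x \<omega>. case_sum \<omega> (\<lambda>_::nat. x)"
  defines "F \<equiv> \<lambda>x N m \<omega>. \<Sum>i\<in>{..<N::nat} <+> {..<m}. \<Sum>j\<in>{..<N} <+> {..<m}. of_bool (D (q x \<omega> i) (q x \<omega> j)) :: real"
  defines "E \<equiv> \<lambda>x N m. real N * (real N - 1) * measure (\<mu> \<Otimes>\<^sub>M \<mu>) {z. D (fst z) (snd z)}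
    + 2 * real m * real N * measure \<mu> {y. D x y}"
  shows "integrable (\<Pi>\<^sub>M k\<in>{..<N}. \<mu>) (F x N m)" (is ?i)
    and "E x N m \<le> (\<integral>\<omega>. F x N m \<omega> \<partial>(\<Pi>\<^sub>M k\<in>{..<N}. \<mu>))" (is ?l)
    and "(\<integral>\<omega>. F x N m \<omega> \<partial>(\<Pi>\<^sub>M k\<in>{..<N}. \<mu>)) \<le> E x N m + real N + (real m)\<^sup>2" (is ?u)
proof -
  interpret prob_space \<mu> by fact
  interpret PP: pair_prob_space \<mu> \<mu> by unfold_locales
  let ?P = "\<Pi>\<^sub>M k\<in>{..<N}. \<mu>"
  interpret P: prob_space ?P by (intro prob_space_PiM assms(1))
  have sp: "space \<mu> = UNIV" using sets_eq_imp_space_eq[OF assms(2)] by simp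
  have D2 [measurable]: "Measurable.pred (\<mu> \<Otimes>\<^sub>M \<mu>) (\<lambda>z. D (fst z) (snd z))"
  proof -
    have "sets (\<mu> \<Otimes>\<^sub>M \<mu>) = sets borel"
      using sets_pair_measure_cong[OF assms(2) assms(2)] by (simp only: borel_prod)
    moreover have "space (\<mu> \<Otimes>\<^sub>M \<mu>) = UNIV"
      by (simp add: space_pair_measure sp)
    ultimately show ?thesis
      using D by (simp add: pred_def)
  qed
  have m1 [measurable]: "Measurable.pred M (\<lambda>w. D (f w) (g w))"
    if [measurable]: "f \<in> borel_measurable M" "g \<in> borel_measurable M" for M and f g :: "'z \<Rightarrow> real"
    using measurable_compose[OF _ D2, of "\<lambda>w. (f w, g w)" M] by simp
  let ?\<pi> = "measure (\<mu> \<Otimes>\<^sub>M \<mu>) {z. D (fst z) (snd z)}" and ?d = "measure \<mu> {y. D x y}"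
  define k where "k y z = (of_bool (D y z) :: real)" for y z
  have [measurable]: "(\<lambda>w. k (f w) (g w)) \<in> borel_measurable M"
    if [measurable]: "f \<in> borel_measurable M" "g \<in> borel_measurable M" for M and f g :: "'z \<Rightarrow> real"
    unfolding k_def of_bool_def by measurable
  have k01: "0 \<le> k y z" "k y z \<le> 1" for y z by (auto simp: k_def)
  \<comment> \<open>The double sum splits into four blocks: sample-sample, two mixed blocks that
    agree by symmetry, and the \<open>m\<^sup>2\<close> pairs of copies of \<open>x\<close>.\<close>
  have F: "F x N m = (\<lambda>\<omega>. (\<Sum>i<N. \<Sum>j<N. k (\<omega> i) (\<omega> j)) + 2 * real m * (\<Sum>i<N. k x (\<omega> i)) + (real m)\<^sup>2 * k x x)"
  proof
    fix \<omega>
    have "F x N m \<omega> = (\<Sum>i<N. \<Sum>j<N. k (\<omega> i) (\<omega> j)) + (\<Sum>i<N. real m * k (\<omega> i) x)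
        + real m * ((\<Sum>i<N. k x (\<omega> i)) + real m * k x x)"
      unfolding F_def q_def by (simp add: sum.Plus sum.distrib distrib_left flip: k_def)
    also have "(\<Sum>i<N. real m * k (\<omega> i) x) = real m * (\<Sum>i<N. k x (\<omega> i))"
      unfolding sum_distrib_left k_def by (subst sym) (rule refl)
    finally show "F x N m \<omega> = (\<Sum>i<N. \<Sum>j<N. k (\<omega> i) (\<omega> j)) + 2 * real m * (\<Sum>i<N. k x (\<omega> i)) + (real m)\<^sup>2 * k x x"
      by (simp add: algebra_simps power2_eq_square)
  qed
  have int1: "integrable ?P (\<lambda>\<omega>. k x (\<omega> i))" if "i < N" for i
    using that k01 by (auto intro!: P.integrable_const_bound[where B=1])
  have int2: "integrable ?P (\<lambda>\<omega>. k (\<omega> i) (\<omega> j))" if "i < N" "j < N" for i j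
    using that k01 by (auto intro!: P.integrable_const_bound[where B=1])
  show ?i unfolding F
    by (intro Bochner_Integration.integrable_add Bochner_Integration.integrable_sum integrable_mult_right) (auto intro: int1 int2)
  have e2: "(\<integral>\<omega>. k (\<omega> i) (\<omega> j) \<partial>?P) = ?\<pi>" if "i < N" "j < N" "i \<noteq> j" for i j
  proof -
    have "(\<integral>\<omega>. k (\<omega> i) (\<omega> j) \<partial>?P) = (\<integral>z. k (fst z) (snd z) \<partial>distr ?P (\<mu> \<Otimes>\<^sub>M \<mu>) (\<lambda>\<omega>. (\<omega> i, \<omega> j)))"
      using that by (subst integral_distr) auto
    also have "\<dots> = (\<integral>z. k (fst z) (snd z) \<partial>(\<mu> \<Otimes>\<^sub>M \<mu>))"
      using that by (subst distr_PiM_pair) (auto intro: \<open>prob_space \<mu>\<close>)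
    also have "\<dots> = (\<integral>z. indicator {z. D (fst z) (snd z)} z \<partial>(\<mu> \<Otimes>\<^sub>M \<mu>))"
      by (intro Bochner_Integration.integral_cong) (auto simp: k_def)
    finally show ?thesis by (simp add: sp space_pair_measure)
  qed
  have e1: "(\<integral>\<omega>. k x (\<omega> i) \<partial>?P) = ?d" if "i < N" for i
  proof -
    have "(\<integral>\<omega>. k x (\<omega> i) \<partial>?P) = (\<integral>y. k x y \<partial>distr ?P \<mu> (\<lambda>\<omega>. \<omega> i))"
      using that by (subst integral_distr) auto
    also have "\<dots> = (\<integral>y. k x y \<partial>\<mu>)"
      using that by (subst distr_PiM_component) (auto intro: \<open>prob_space \<mu>\<close>)
    also have "\<dots> = (\<integral>y. indicator {y. D x y} y \<partial>\<mu>)"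
      by (intro Bochner_Integration.integral_cong) (auto simp: k_def)
    finally show ?thesis by (simp add: sp)
  qed
  have I: "(\<integral>\<omega>. F x N m \<omega> \<partial>?P) = (\<Sum>i<N. \<Sum>j<N. \<integral>\<omega>. k (\<omega> i) (\<omega> j) \<partial>?P) + 2 * real m * real N * ?d + (real m)\<^sup>2 * k x x"
  proof -
    have "integrable ?P (\<lambda>\<omega>. \<Sum>i<N. \<Sum>j<N. k (\<omega> i) (\<omega> j))"
      by (intro Bochner_Integration.integrable_sum int2) auto
    moreover have "integrable ?P (\<lambda>\<omega>. 2 * real m * (\<Sum>i<N. k x (\<omega> i)))"
      by (intro Bochner_Integration.integrable_sum integrable_mult_right int1) auto
    moreover have "(\<integral>\<omega>. (\<Sum>i<N. \<Sum>j<N. k (\<omega> i) (\<omega> j)) \<partial>?P) = (\<Sum>i<N. \<Sum>j<N. \<integral>\<omega>. k (\<omega> i) (\<omega> j) \<partial>?P)"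
      by (subst Bochner_Integration.integral_sum)
         (auto intro!: sum.cong Bochner_Integration.integral_sum Bochner_Integration.integrable_sum int2)
    moreover have "(\<integral>\<omega>. (\<Sum>i<N. k x (\<omega> i)) \<partial>?P) = real N * ?d"
      by (simp add: Bochner_Integration.integral_sum int1 e1)
    ultimately show ?thesis
      unfolding F by (simp add: P.prob_space)
  qed
  \<comment> \<open>Off the diagonal the expectation is exactly the product probability. On the
    diagonal it is only known to lie in [0, 1], so \<open>c = 0\<close> serves the lower bound and
    \<open>c = 1\<close> the upper one.\<close>
  have diag: "(\<Sum>i<N. \<Sum>j<N. if i = j then c else ?\<pi>) = real N * (real N - 1) * ?\<pi> + real N * c" for c
  proof -
    have "(\<Sum>j<N. if i = j then c else ?\<pi>) = (real N - 1) * ?\<pi> + c" if "i < N" for i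
    proof -
      have "(\<Sum>j<N. if i = j then c else ?\<pi>) = (\<Sum>j<N. ?\<pi> + (if i = j then c - ?\<pi> else 0))"
        by (intro sum.cong) auto
      then show ?thesis using that by (simp add: sum.distrib algebra_simps)
    qed
    then have "(\<Sum>i<N. \<Sum>j<N. if i = j then c else ?\<pi>) = (\<Sum>i<N. (real N - 1) * ?\<pi> + c)"
      by (intro sum.cong) auto
    then show ?thesis by (simp add: algebra_simps)
  qed
  have "(\<Sum>i<N. \<Sum>j<N. if i = j then 0 else ?\<pi>) \<le> (\<Sum>i<N. \<Sum>j<N. \<integral>\<omega>. k (\<omega> i) (\<omega> j) \<partial>?P)"
    using e2 k01 by (intro sum_mono) (auto intro: integral_nonneg_AE)
  then show ?l unfolding I E_def diag using mult_nonneg_nonneg[OF zero_le_power2 k01(1), of "real m" x x] by simp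
  have "(\<integral>\<omega>. k (\<omega> i) (\<omega> i) \<partial>?P) \<le> 1" if "i < N" for i
    using that k01 by (intro P.integral_le_const int2) auto
  then have "(\<Sum>i<N. \<Sum>j<N. \<integral>\<omega>. k (\<omega> i) (\<omega> j) \<partial>?P) \<le> (\<Sum>i<N. \<Sum>j<N. if i = j then 1 else ?\<pi>)"
    using e2 by (intro sum_mono) auto
  then show ?u unfolding I E_def diag using mult_left_mono[OF k01(2)[of x x], of "(real m)\<^sup>2"] by simp
qed

text \<open>The counting inequality holds for every outcome and is integrated over the sample. The
  error consists of \<open>N + m\<^sup>2\<close> from the upper estimate for \<open>T\<close> and
  \<open>N + m\<close> from the number of points.\<close>

lemma sampling_inequality:
  fixes \<mu> :: "real measure"
  assumes "prob_space \<mu>" and sets: "sets \<mu> = sets borel"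
    and "0 < a" "0 < n" "2 * b \<le> real n * a"
  defines "S \<equiv> measure (\<mu> \<Otimes>\<^sub>M \<mu>) {z. \<bar>fst z + snd z\<bar> \<le> b}"
    and "T \<equiv> measure (\<mu> \<Otimes>\<^sub>M \<mu>) {z. \<bar>fst z - snd z\<bar> \<le> a}"
  shows "real N * (real N - 1) * S + 2 * real m * real N * measure \<mu> {y. \<bar>x + y\<bar> \<le> b}
    \<le> real n * (real N * (real N - 1) * T + 2 * real m * real N * measure \<mu> {y. \<bar>x - y\<bar> \<le> a}
        + 2 * real N + real m + (real m)\<^sup>2)"
proof -
  let ?P = "\<Pi>\<^sub>M k\<in>{..<N}. \<mu>"
  interpret P: prob_space ?P by (intro prob_space_PiM assms(1))
  let ?I = "{..<N} <+> {..<m}" and ?q = "\<lambda>\<omega>. case_sum \<omega> (\<lambda>_::nat. x)"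
  have bS: "{z::real \<times> real. \<bar>fst z + snd z\<bar> \<le> b} \<in> sets borel"
    and bT: "{z::real \<times> real. \<bar>fst z - snd z\<bar> \<le> a} \<in> sets borel"
    by (intro borel_closed closed_Collect_le continuous_intros)+
  let ?FS = "\<lambda>\<omega>. \<Sum>i\<in>?I. \<Sum>j\<in>?I. of_bool (\<bar>?q \<omega> i + ?q \<omega> j\<bar> \<le> b) :: real"
    and ?FT = "\<lambda>\<omega>. \<Sum>i\<in>?I. \<Sum>j\<in>?I. of_bool (\<bar>?q \<omega> i - ?q \<omega> j\<bar> \<le> a) :: real"
  have symS: "\<bar>x + y\<bar> \<le> b \<longleftrightarrow> \<bar>y + x\<bar> \<le> b" and symT: "\<bar>x - y\<bar> \<le> a \<longleftrightarrow> \<bar>y - x\<bar> \<le> a" for x y :: real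
    by (simp_all add: add.commute abs_minus_commute)
  note eS = expected_pairs[where D = "\<lambda>x y. \<bar>x + y\<bar> \<le> b" and N = N and x = x and m = m, OF assms(1,2) bS symS]
  note eT = expected_pairs[where D = "\<lambda>x y. \<bar>x - y\<bar> \<le> a" and N = N and x = x and m = m, OF assms(1,2) bT symT]
  have "real N * (real N - 1) * S + 2 * real m * real N * measure \<mu> {y. \<bar>x + y\<bar> \<le> b} \<le> (\<integral>\<omega>. ?FS \<omega> \<partial>?P)"
    unfolding S_def by (rule eS(2))
  also have "\<dots> \<le> (\<integral>\<omega>. real n * ?FT \<omega> + real n * real (card ?I) \<partial>?P)"
  proof (rule integral_mono[OF eS(1)])
    show "integrable ?P (\<lambda>\<omega>. real n * ?FT \<omega> + real n * real (card ?I))"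
      by (intro Bochner_Integration.integrable_add integrable_mult_right eT(1) P.integrable_const)
    show "?FS \<omega> \<le> real n * ?FT \<omega> + real n * real (card ?I)" for \<omega>
      by (rule card_sum_pairs_le[OF _ assms(3-5)]) simp
  qed
  also have "\<dots> = real n * (\<integral>\<omega>. ?FT \<omega> \<partial>?P) + real n * real (card ?I)"
    by (subst Bochner_Integration.integral_add[OF integrable_mult_right[OF eT(1)] P.integrable_const])
       (simp only: integral_mult_right_zero lebesgue_integral_const P.prob_space real_scaleR_def mult_1)
  also have "\<dots> \<le> real n * (real N * (real N - 1) * T + 2 * real m * real N * measure \<mu> {y. \<bar>x - y\<bar> \<le> a}
        + real N + (real m)\<^sup>2) + real n * real (card ?I)"
    unfolding T_def by (rule add_right_mono[OF mult_left_mono[OF eT(3)]]) simp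
  also have "card ?I = N + m"
    by (simp add: card_Plus)
  finally show ?thesis by (simp add: algebra_simps)
qed

section \<open>Large samples: the weak inequality and the first-order condition\<close>

lemma nonpos_if_multiples_bounded:
  fixes c d :: real
  assumes "\<And>k::nat. real k * c \<le> d"
  shows "c \<le> 0"
proof (rule ccontr)
  assume "\<not> c \<le> 0"
  then obtain k where "d < real k * c" using ex_less_of_nat_mult[of c d] by auto
  with assms[of k] show False by simp
qed

lemma (in real_distribution) weak_inequality:
  assumes "0 < a" "0 < n" "2 * b \<le> real n * a"
  shows "measure (M \<Otimes>\<^sub>M M) {z. \<bar>fst z + snd z\<bar> \<le> b}
    \<le> real n * measure (M \<Otimes>\<^sub>M M) {z. \<bar>fst z - snd z\<bar> \<le> a}" (is "?S \<le> real n * ?T")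
proof -
  have "real k * (?S - real n * ?T) \<le> 2 * real n" for k
  proof -
    \<comment> \<open>No copies are added (\<open>m = 0\<close>) and \<open>N = k + 1\<close>:
      dividing by \<open>N\<close> leaves \<open>k (S - n T)\<close> bounded by a constant.\<close>
    have "real (Suc k) * (real k * ?S) \<le> real (Suc k) * (real n * real k * ?T + 2 * real n)"
      using sampling_inequality[OF prob_space_axioms events_eq_borel assms, of "Suc k" 0 0]
      by (simp add: algebra_simps)
    then have "real k * ?S \<le> real n * real k * ?T + 2 * real n"
      by (rule mult_left_le_imp_le) simp
    then show ?thesis by (simp add: algebra_simps)
  qed
  from nonpos_if_multiples_bounded[OF this] show ?thesis by simp
qed

text \<open>First-order optimality: in the case of equality \<open>M\<close> minimizes the quadratic form
  \<open>n T - S\<close>, which vanishes there, so its derivative in the direction of every point mass is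
  nonnegative. In the sampling inequality this is seen by adding \<open>m\<close> copies of \<open>x\<close>
  to \<open>m\<^sup>2\<close> samples.\<close>

lemma (in real_distribution) equality_imp_pointwise:
  assumes "0 < a" "0 < n" "2 * b \<le> real n * a"
    and eq: "measure (M \<Otimes>\<^sub>M M) {z. \<bar>fst z + snd z\<bar> \<le> b}
      = real n * measure (M \<Otimes>\<^sub>M M) {z. \<bar>fst z - snd z\<bar> \<le> a}"
  shows "prob {y. \<bar>x + y\<bar> \<le> b} \<le> real n * prob {y. \<bar>x - y\<bar> \<le> a}" (is "?g \<le> real n * ?f")
proof -
  have "real k * (?g - real n * ?f) \<le> 2 * real n" for k
  proof (cases "k = 0")
    case False
    \<comment> \<open>By \<open>eq\<close> the sample-sample terms cancel. The mixed terms have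
      order \<open>k ^ 3\<close> and the errors only \<open>k ^ 2\<close>, so dividing by
      \<open>2 k ^ 2\<close> again bounds all multiples of one number.\<close>
    have "2 * real k ^ 3 * ?g \<le> real n * (2 * real k ^ 3 * ?f + 3 * (real k)\<^sup>2 + real k)"
      using sampling_inequality[OF prob_space_axioms events_eq_borel assms(1-3), of "k\<^sup>2" k x]
      unfolding eq by (simp add: algebra_simps power2_eq_square power3_eq_cube)
    also have "\<dots> \<le> real n * (2 * real k ^ 3 * ?f + 4 * (real k)\<^sup>2)"
      using self_le_power[of "real k" 2] False by (intro mult_left_mono) auto
    finally have "(2 * (real k)\<^sup>2) * (real k * (?g - real n * ?f)) \<le> (2 * (real k)\<^sup>2) * (2 * real n)"
      by (simp add: algebra_simps power2_eq_square power3_eq_cube)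
    then show ?thesis
      by (rule mult_left_le_imp_le) (use False in simp)
  qed simp
  from nonpos_if_multiples_bounded[OF this] show ?thesis by simp
qed

section \<open>Masses of intervals of a fixed length\<close>

lemma (in real_distribution) prob_tiles_le:
  assumes "0 \<le> a" "0 < n" "\<And>u. prob {u..u + a} \<le> t"
  shows "prob {u..u + real n * a} \<le> real n * t"
proof -
  have "prob {u..u + real n * a} \<le> prob (\<Union>k<n. {u + real k * a..u + real k * a + a})"
    using assms by (intro finite_measure_mono atLeastAtMost_tiles) auto
  also have "\<dots> \<le> (\<Sum>k<n. prob {u + real k * a..u + real k * a + a})"
    by (rule finite_measure_subadditive_finite) auto
  also have "\<dots> \<le> (\<Sum>k<n. t)"
    by (intro sum_mono assms)
  finally show ?thesis by simp
qed

lemma (in real_distribution) tails_small: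
  assumes "0 < e"
  obtains R where "\<And>x. R < x \<Longrightarrow> prob {x..} < e" "\<And>x. x < - R \<Longrightarrow> prob {..x} < e"
proof -
  have "eventually (\<lambda>x. cdf M x > 1 - e) at_top"
    using order_tendstoD(1)[OF cdf_lim_at_top_prob] assms by simp
  then obtain R1 where R1: "\<And>x. R1 \<le> x \<Longrightarrow> cdf M x > 1 - e"
    unfolding eventually_at_top_linorder by blast
  have "eventually (\<lambda>x. cdf M x < e) at_bot"
    using order_tendstoD(2)[OF cdf_lim_at_bot] assms by simp
  then obtain R2 where R2: "\<And>x. x \<le> R2 \<Longrightarrow> cdf M x < e"
    unfolding eventually_at_bot_linorder by blast
  show thesis
  proof
    \<comment> \<open>The shift by 1 is needed because \<open>{x..}\<close> contains
      \<open>x\<close>: its complement \<open>{..<x}\<close> still includes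
      \<open>{..x - 1}\<close>, whose mass is the distribution function at
      \<open>x - 1\<close>.\<close>
    fix x assume "max (R1 + 1) (- R2) < x"
    then have "1 - e < cdf M (x - 1)" by (intro R1) auto
    also have "\<dots> \<le> prob {..<x}"
      unfolding cdf_def by (intro finite_measure_mono) auto
    also have "\<dots> = 1 - prob {x..}"
      using prob_compl[of "{x..}"] by (simp add: Compl_eq_Diff_UNIV[symmetric] Compl_atLeast)
    finally show "prob {x..} < e" by simp
  next
    fix x assume "x < - max (R1 + 1) (- R2)"
    then show "prob {..x} < e" using R2[of x] by (simp add: cdf_def)
  qed
qed

text \<open>The supremum of the masses is attained by compactness: nearly optimal intervals cannot
  escape to infinity, their left ends accumulate, and continuity from above applies because the
  intervals are closed.\<close>

lemma (in real_distribution) heaviest_interval: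
  assumes "0 < a"
  obtains u where "0 < prob {u..u + a}" "\<And>v. prob {v..v + a} \<le> prob {u..u + a}"
proof -
  define t where "t = (SUP u. prob {u..u + a})"
  have bdd: "bdd_above (range (\<lambda>u. prob {u..u + a}))"
    by (rule bdd_aboveI[of _ 1]) auto
  have le: "prob {u..u + a} \<le> t" for u
    unfolding t_def by (rule cSUP_upper[OF _ bdd]) simp
  \<comment> \<open>Otherwise all tiles are null, while finitely many of them and two tails of mass
    below 1/2 cover the line.\<close>
  have "0 < t"
  proof (rule ccontr)
    assume "\<not> 0 < t"
    then have le0: "prob {u..u + a} \<le> 0" for u using le[of u] by linarith
    obtain R where R: "\<And>x. R < x \<Longrightarrow> prob {x..} < 1/2" "\<And>x. x < - R \<Longrightarrow> prob {..x} < 1/2"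
      using tails_small[of "1/2"] by auto
    define r where "r = \<bar>R\<bar> + 1"
    obtain n where n: "2 * r / a < real n"
      using reals_Archimedean2 by blast
    have "0 < n" using n assms by (cases n) (auto simp: r_def divide_less_0_iff)
    have "1 = prob ({..- r} \<union> {- r..- r + real n * a} \<union> {r..})"
    proof -
      have "{..- r} \<union> {- r..- r + real n * a} \<union> {r..} = UNIV"
        using n assms by (auto simp: field_simps)
      then show ?thesis using prob_space by simp
    qed
    also have "\<dots> \<le> prob {..- r} + prob {- r..- r + real n * a} + prob {r..}"
      by (intro order_trans[OF measure_Un_le] add_right_mono measure_Un_le) auto
    also have "prob {- r..- r + real n * a} \<le> real n * 0"
      using assms \<open>0 < n\<close> by (intro prob_tiles_le le0) auto
    finally show False using R(1)[of r] R(2)[of "- r"] abs_ge_self[of R] abs_ge_minus_self[of R]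
      unfolding r_def by linarith
  qed
  \<comment> \<open>The deficit tends to 0 and never exceeds \<open>t / 2\<close>. Hence every
    chosen interval has mass above \<open>t / 2\<close> and must meet a fixed bounded
    region.\<close>
  have "\<exists>u. prob {u..u + a} > t - t / 2 * inverse (real (Suc k))" for k
  proof -
    have "t - t / 2 * inverse (real (Suc k)) < t" using \<open>0 < t\<close> by simp
    then show ?thesis unfolding t_def using less_cSUP_iff[OF _ bdd] by (metis UNIV_I UNIV_not_empty)
  qed
  then obtain u where u: "\<And>k. prob {u k..u k + a} > t - t / 2 * inverse (real (Suc k))" by metis
  have u2: "prob {u k..u k + a} > t / 2" for k
  proof -
    have "t / 2 * inverse (real (Suc k)) \<le> t / 2 * 1"
      using \<open>0 < t\<close> by (intro mult_left_mono) (auto simp: field_simps)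
    then show ?thesis using u[of k] by linarith
  qed
  obtain R where R: "\<And>x. R < x \<Longrightarrow> prob {x..} < t/2" "\<And>x. x < - R \<Longrightarrow> prob {..x} < t/2"
    using tails_small[of "t/2"] \<open>0 < t\<close> by auto
  have "u k \<in> {- R - a..R}" for k
  proof -
    have "prob {u k..u k + a} \<le> prob {u k..}" "prob {u k..u k + a} \<le> prob {..u k + a}"
      by (auto intro!: finite_measure_mono)
    then show ?thesis using R(1)[of "u k"] R(2)[of "u k + a"] u2[of k] by force
  qed
  then obtain l r where r: "strict_mono r" and l: "(u \<circ> r) \<longlonglongrightarrow> l"
    using compact_Icc[of "- R - a" R] unfolding compact_def by blast
  \<comment> \<open>Closed neighbourhoods shrinking to \<open>{l..l + a}\<close>. Each contains all
    chosen intervals of the subsequence from some index on, so it has mass at least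
    \<open>t\<close>.\<close>
  define A where "A j = {l - inverse (real (Suc j))..l + a + inverse (real (Suc j))}" for j
  have "t \<le> prob (A j)" for j
  proof (rule LIMSEQ_le_const2)
    have "(\<lambda>k. t - t / 2 * inverse (real (Suc k))) \<longlonglongrightarrow> t - t / 2 * 0"
      by (intro tendsto_intros LIMSEQ_inverse_real_of_nat)
    then show "(\<lambda>k. t - t / 2 * inverse (real (Suc (r k)))) \<longlonglongrightarrow> t"
      using LIMSEQ_subseq_LIMSEQ[OF _ r] by (fastforce simp: o_def)
    have "eventually (\<lambda>k. dist ((u \<circ> r) k) l < inverse (real (Suc j))) sequentially"
      using l by (rule tendstoD) simp
    then obtain K where K: "\<And>k. K \<le> k \<Longrightarrow> dist (u (r k)) l < inverse (real (Suc j))"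
      unfolding eventually_sequentially by auto
    show "\<exists>K. \<forall>k\<ge>K. t - t / 2 * inverse (real (Suc (r k))) \<le> prob (A j)"
    proof (intro exI allI impI)
      fix k assume "K \<le> k"
      then have "prob {u (r k)..u (r k) + a} \<le> prob (A j)"
        using K[of k] by (intro finite_measure_mono) (auto simp: A_def dist_real_def)
      then show "t - t / 2 * inverse (real (Suc (r k))) \<le> prob (A j)"
        using u[of "r k"] by linarith
    qed
  qed
  moreover have "(\<lambda>j. prob (A j)) \<longlonglongrightarrow> prob (\<Inter>j. A j)"
    by (rule finite_Lim_measure_decseq)
       (auto simp: A_def decseq_def intro: order_trans[OF diff_left_mono] order_trans[OF _ add_left_mono] le_imp_inverse_le)
  moreover have "(\<Inter>j. A j) = {l..l + a}"
  proof (intro equalityI subsetI)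
    fix x assume x: "x \<in> (\<Inter>j. A j)"
    have i: "(\<lambda>j. inverse (real (Suc j))) \<longlonglongrightarrow> 0" by (rule LIMSEQ_inverse_real_of_nat)
    have "l - 0 \<le> x"
      by (rule LIMSEQ_le_const2[OF tendsto_diff[OF tendsto_const i]]) (use x in \<open>auto simp: A_def\<close>)
    moreover have "x \<le> l + a + 0"
      by (rule LIMSEQ_le_const[OF tendsto_add[OF tendsto_const i]]) (use x in \<open>auto simp: A_def\<close>)
    ultimately show "x \<in> {l..l + a}" by simp
  qed (auto simp: A_def intro: order_trans[of _ l] order_trans[of _ "l + a"])
  ultimately have "t \<le> prob {l..l + a}"
    by (metis LIMSEQ_le_const)
  then show thesis using le \<open>0 < t\<close> that[of l] by (meson order_trans less_le_trans)
qed

section \<open>Strictness for at least two tiles\<close>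

lemma (in real_distribution) measure_pair_eq_integral:
  assumes "{z. D (fst z) (snd z)} \<in> sets (borel :: (real \<times> real) measure)"
  shows "measure (M \<Otimes>\<^sub>M M) {z. D (fst z) (snd z)} = (\<integral>x. prob {y. D x y} \<partial>M)"
    and "integrable M (\<lambda>x. prob {y. D x y})"
proof -
  interpret PP: pair_prob_space M M by unfold_locales
  let ?D = "{z. D (fst z) (snd z)}"
  have D: "?D \<in> sets (M \<Otimes>\<^sub>M M)"
    using assms sets_pair_measure_cong[OF events_eq_borel events_eq_borel] by (simp only: borel_prod)
  have s: "(\<lambda>y. indicator ?D (x, y) :: real) = indicator {y. D x y}" for x
    by (auto simp: indicator_def)
  have int: "integrable (M \<Otimes>\<^sub>M M) (indicator ?D :: _ \<Rightarrow> real)"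
    using D by (simp add: PP.emeasure_eq_measure)
  show "integrable M (\<lambda>x. prob {y. D x y})"
    using PP.integrable_fst'[OF int] by (simp add: s)
  have "measure (M \<Otimes>\<^sub>M M) ?D = (\<integral>z. indicator ?D z \<partial>(M \<Otimes>\<^sub>M M))"
    by (simp add: space_pair_measure)
  also have "\<dots> = (\<integral>x. prob {y. D x y} \<partial>M)"
    using PP.integral_fst'[OF int] by (simp add: s)
  finally show "measure (M \<Otimes>\<^sub>M M) ?D = (\<integral>x. prob {y. D x y} \<partial>M)" .
qed

text \<open>Stated for the largest radius that belongs to \<open>n\<close>, where the window around
  \<open>- x\<close> is tiled exactly by \<open>n\<close> intervals of length \<open>a\<close>;
  smaller radii follow by monotonicity.\<close>

lemma (in real_distribution) strict_inequality:
  assumes "0 < a" "2 \<le> n"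
  shows "measure (M \<Otimes>\<^sub>M M) {z. \<bar>fst z + snd z\<bar> \<le> real n * a / 2}
    < real n * measure (M \<Otimes>\<^sub>M M) {z. \<bar>fst z - snd z\<bar> \<le> a}" (is "?S < real n * ?T")
proof (rule ccontr)
  assume "\<not> ?S < real n * ?T"
  then have eq: "?S = real n * ?T"
    using weak_inequality[of a n "real n * a / 2"] assms by simp
  define h where "h = real n * a / 2"
  have "a \<le> h" using assms by (simp add: h_def)
  define f where "f x = prob {y. \<bar>x - y\<bar> \<le> a}" for x
  define g where "g x = prob {y. \<bar>x + y\<bar> \<le> h}" for x
  have f: "f x = prob {x - a..x + a}" and g: "g x = prob {- x - h..- x + h}" for x
    unfolding f_def g_def by (auto intro!: arg_cong[where f=prob])
  define G where "G = {x. real n * f x = g x}"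
  have G: "AE x in M. x \<in> G"
  proof -
    have bS: "{z::real \<times> real. \<bar>fst z + snd z\<bar> \<le> h} \<in> sets borel"
      and bT: "{z::real \<times> real. \<bar>fst z - snd z\<bar> \<le> a} \<in> sets borel"
      by (intro borel_closed closed_Collect_le continuous_intros)+
    note S = measure_pair_eq_integral[of "\<lambda>x y. \<bar>x + y\<bar> \<le> h", OF bS, folded g_def]
    note T = measure_pair_eq_integral[of "\<lambda>x y. \<bar>x - y\<bar> \<le> a", OF bT, folded f_def]
    \<comment> \<open>The integrand is nonnegative by the first-order condition and integrates to
      \<open>n T - S = 0\<close>, so it vanishes almost everywhere.\<close>
    have "(\<integral>x. real n * f x - g x \<partial>M) = 0"
      using eq S T by (simp add: h_def)
    moreover have "0 \<le> real n * f x - g x" for x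
      using equality_imp_pointwise[OF _ _ _ eq, of x] assms by (simp add: f_def g_def h_def)
    ultimately have "AE x in M. real n * f x - g x = 0"
      using S(2) T(2) by (subst (asm) integral_nonneg_eq_0_iff_AE) auto
    then show ?thesis by (auto simp: G_def)
  qed
  have pick: "\<exists>x\<in>A. x \<in> G" if "0 < prob A" "A \<in> sets borel" for A
  proof (rule ccontr)
    assume "\<not> ?thesis"
    then have "AE x in M. x \<notin> A" using G by auto
    then show False using that prob_eq_0[of A] by simp
  qed
  obtain u0 where u0: "0 < prob {u0..u0 + a}" "\<And>v. prob {v..v + a} \<le> prob {u0..u0 + a}"
    using heaviest_interval[OF \<open>0 < a\<close>] by blast
  define t where "t = prob {u0..u0 + a}"
  have "0 < t" and le_t: "\<And>v. prob {v..v + a} \<le> t"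
    using u0 by (auto simp: t_def)
  define A where "A = {x\<in>G. f x = t}"
  \<comment> \<open>The window of radius \<open>a\<close> around \<open>x\<close> contains the tile,
    so \<open>f x \<ge> t\<close>. Conversely \<open>n f x = g x \<le> n t\<close>, as
    \<open>g x\<close> is the mass of \<open>n\<close> tiles.\<close>
  have inA: "x \<in> A" if "x \<in> G" "x \<in> {u..u + a}" "t \<le> prob {u..u + a}" for x u
  proof -
    have "t \<le> f x"
      unfolding f using that by (intro order_trans[OF that(3)] finite_measure_mono) auto
    moreover have "prob {- x - h..- x - h + real n * a} \<le> real n * t"
      using assms by (intro prob_tiles_le le_t) auto
    then have "real n * f x \<le> real n * t"
      using that(1) by (simp add: G_def g h_def mult.commute)
    then have "f x \<le> t" using assms by simp
    ultimately show ?thesis using that(1) by (simp add: A_def)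
  qed
  \<comment> \<open>The full window has mass \<open>n t\<close> and the other \<open>n - 1\<close>
    closed tiles take at most \<open>(n - 1) t\<close>. Leaving the shared endpoint to them makes
    the end tile half-open, which yields strict inequalities in \<open>below\<close>.\<close>
  have end_tiles: "t \<le> prob {- x - h..<- x - h + a}" "t \<le> prob {- x + h - a<..- x + h}" if "x \<in> A" for x
  proof -
    have g_eq: "g x = real n * t" using that by (auto simp: A_def G_def)
    have n1: "real (n - 1) = real n - 1" using assms by simp
    have na: "real (n - 1) * a = 2 * h - a" by (simp only: n1) (simp add: h_def algebra_simps)
    have rest: "prob {v..v + real (n - 1) * a} \<le> (real n - 1) * t" for v
      unfolding n1[symmetric] using assms by (intro prob_tiles_le le_t) auto
    have "prob {- x - h..- x + h} \<le> prob ({- x - h..<- x - h + a} \<union> {- x - h + a..- x - h + a + real (n - 1) * a})"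
      unfolding na by (intro finite_measure_mono) auto
    also have "\<dots> \<le> prob {- x - h..<- x - h + a} + prob {- x - h + a..- x - h + a + real (n - 1) * a}"
      by (rule measure_Un_le) auto
    finally show "t \<le> prob {- x - h..<- x - h + a}"
      using g_eq rest[of "- x - h + a"] by (simp add: g algebra_simps)
    have "prob {- x - h..- x + h} \<le> prob ({- x - h..- x - h + real (n - 1) * a} \<union> {- x + h - a<..- x + h})"
      unfolding na by (intro finite_measure_mono) auto
    also have "\<dots> \<le> prob {- x - h..- x - h + real (n - 1) * a} + prob {- x + h - a<..- x + h}"
      by (rule measure_Un_le) auto
    finally show "t \<le> prob {- x + h - a<..- x + h}"
      using g_eq rest[of "- x - h"] by (simp add: g algebra_simps)
  qed
  \<comment> \<open>The supremum \<open>s\<close> makes sense: \<open>A\<close> is nonempty because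
    the heaviest interval meets \<open>G\<close>, and bounded above because a window of mass
    \<open>t\<close> cannot lie far to the right.\<close>
  obtain x0 where "x0 \<in> {u0..u0 + a}" "x0 \<in> G"
    using pick[of "{u0..u0 + a}"] u0(1) by auto
  then have "x0 \<in> A"
    using inA[of x0 u0] by (simp add: t_def)
  obtain R where R: "\<And>x. R < x \<Longrightarrow> prob {x..} < t"
    using tails_small[OF \<open>0 < t\<close>] by blast
  have bdd: "bdd_above A"
  proof (rule bdd_aboveI)
    fix x assume "x \<in> A"
    then have "t \<le> prob {x - a..}"
      unfolding A_def f by (auto intro!: finite_measure_mono)
    then show "x \<le> R + a" using R[of "x - a"] by linarith
  qed
  define s where "s = Sup A"
  \<comment> \<open>Almost every \<open>y\<close> in the left end tile of \<open>x\<close> lies in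
    \<open>A\<close>, so the right end tile of \<open>y\<close> contains some \<open>z\<close> in
    \<open>A\<close>. Since \<open>a \<le> h\<close>, this gives \<open>y < - x\<close> and
    \<open>- y < z \<le> s\<close>; the whole left tile is squeezed into \<open>{- s<..<- x}\<close>
    up to a null set.\<close>
  have below: "t \<le> prob {- s<..<- x}" if "x \<in> A" for x
  proof -
    have "AE y in M. y \<in> {- x - h..<- x - h + a} \<longrightarrow> y \<in> {- s<..<- x}"
      using G
    proof eventually_elim
      case (elim y)
      show ?case
      proof
        assume y: "y \<in> {- x - h..<- x - h + a}"
        have "t \<le> prob {- x - h..- x - h + a}"
          by (rule order_trans[OF end_tiles(1)[OF that]]) (auto intro!: finite_measure_mono)
        then have "y \<in> A" using elim y by (intro inA[of _ "- x - h"]) auto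
        note ty = end_tiles(2)[OF this]
        obtain z where z: "z \<in> {- y + h - a<..- y + h}" "z \<in> G"
          using pick[of "{- y + h - a<..- y + h}"] ty \<open>0 < t\<close> by auto
        have "t \<le> prob {- y + h - a..- y + h - a + a}"
          by (rule order_trans[OF ty]) (auto intro!: finite_measure_mono)
        then have "z \<in> A" using z by (intro inA[of _ "- y + h - a"]) auto
        then have "z \<le> s" unfolding s_def by (rule cSup_upper[OF _ bdd])
        then show "y \<in> {- s<..<- x}" using z y \<open>a \<le> h\<close> by auto
      qed
    qed
    then have "prob {- x - h..<- x - h + a} \<le> prob {- s<..<- x}"
      by (rule finite_measure_mono_AE) simp
    then show ?thesis using end_tiles(1)[OF that] by simp
  qed
  \<comment> \<open>Open at \<open>- s\<close>, these sets have empty intersection, so their masses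
    tend to 0. For \<open>x\<close> in \<open>A\<close> close to \<open>s\<close>,
    \<open>{- s<..<- x}\<close> lies inside such a set, against \<open>below\<close>.\<close>
  define B where "B j = {- s<..<- s + inverse (real (Suc j))}" for j
  have "(\<lambda>j. prob (B j)) \<longlonglongrightarrow> prob (\<Inter>j. B j)"
  proof (rule finite_Lim_measure_decseq)
    show "decseq B"
    proof (rule antimonoI)
      fix i j :: nat assume "i \<le> j"
      then have "inverse (real (Suc j)) \<le> inverse (real (Suc i))"
        by (intro le_imp_inverse_le) auto
      then show "B j \<subseteq> B i"
        unfolding B_def greaterThanLessThan_subseteq_greaterThanLessThan by (intro impI conjI add_left_mono) simp
    qed
  qed (simp add: B_def image_subset_iff)
  moreover have "(\<Inter>j. B j) = {}"
  proof -
    have "y \<notin> (\<Inter>j. B j)" for y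
    proof
      assume y: "y \<in> (\<Inter>j. B j)"
      then have "0 < y + s" by (auto simp: B_def)
      then obtain j where "inverse (real (Suc j)) < y + s" using reals_Archimedean by blast
      moreover have "y \<in> B j" using y by blast
      ultimately show False by (auto simp: B_def)
    qed
    then show ?thesis by blast
  qed
  ultimately have "(\<lambda>j. prob (B j)) \<longlonglongrightarrow> 0" by simp
  then have "eventually (\<lambda>j. prob (B j) < t) sequentially"
    using \<open>0 < t\<close> by (rule order_tendstoD)
  then obtain j where j: "prob (B j) < t" by (auto dest: eventually_happens)
  have "s - inverse (real (Suc j)) < s" by simp
  then obtain x where x: "x \<in> A" "s - inverse (real (Suc j)) < x"
    unfolding s_def using less_cSupD[of A] \<open>x0 \<in> A\<close> by blast
  have "prob {- s<..<- x} \<le> prob (B j)"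
    using x(2) by (intro finite_measure_mono) (auto simp: B_def)
  then show False using below[OF x(1)] j by simp
qed

section \<open>From i.i.d. pairs to product laws and back\<close>

lemma real_distribution_distr_iid_pair:
  assumes "iid_pair M X Y"
  shows "real_distribution (distr M borel X)"
proof -
  interpret prob_space M using assms by (simp add: iid_pair_def)
  show ?thesis
    using assms by (intro real_distribution_distr) (auto simp: iid_pair_def dest: indep_var_rv1)
qed

lemma prob_iid_pair:
  fixes D :: "real \<Rightarrow> real \<Rightarrow> bool"
  assumes "iid_pair M X Y" and D: "{z. D (fst z) (snd z)} \<in> sets borel"
  shows "\<P>(\<omega> in M. D (X \<omega>) (Y \<omega>))
    = measure (distr M borel X \<Otimes>\<^sub>M distr M borel X) {z. D (fst z) (snd z)}"
proof -
  interpret prob_space M using assms by (simp add: iid_pair_def)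
  have "distr M borel X \<Otimes>\<^sub>M distr M borel X = distr M (borel \<Otimes>\<^sub>M borel) (\<lambda>\<omega>. (X \<omega>, Y \<omega>))"
    and [measurable]: "random_variable borel X" "random_variable borel Y"
    using assms(1) unfolding iid_pair_def indep_var_distribution_eq by auto
  then show ?thesis
    using D by (simp add: measure_distr borel_prod vimage_def Int_def conj_commute)
qed

text \<open>Realizes a prescribed law by the two coordinates on its square. Sharpness thus only
  requires a law on the line, with a measure on \<open>real \<times> real\<close> as
  witness.\<close>

lemma (in real_distribution) iid_pair_fst_snd: "iid_pair (M \<Otimes>\<^sub>M M) fst snd"
proof -
  interpret PP: pair_prob_space M M by unfold_locales
  have "distr (M \<Otimes>\<^sub>M M) borel fst = distr (M \<Otimes>\<^sub>M M) M fst"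
    by (rule distr_cong) auto
  then have 1: "distr (M \<Otimes>\<^sub>M M) borel fst = M"
    using distr_pair_fst by simp
  have "distr (M \<Otimes>\<^sub>M M) borel snd = distr (distr (M \<Otimes>\<^sub>M M) (M \<Otimes>\<^sub>M M) (\<lambda>(x, y). (y, x))) borel snd"
    using PP.distr_pair_swap by simp
  also have "\<dots> = distr (M \<Otimes>\<^sub>M M) borel fst"
    by (subst distr_distr) (auto simp: o_def case_prod_beta intro!: distr_cong)
  finally have 2: "distr (M \<Otimes>\<^sub>M M) borel snd = M"
    using 1 by simp
  have "distr (M \<Otimes>\<^sub>M M) (borel \<Otimes>\<^sub>M borel) (\<lambda>z. (fst z, snd z)) = M \<Otimes>\<^sub>M M"
    using distr_id2[of "borel \<Otimes>\<^sub>M borel" "M \<Otimes>\<^sub>M M"] sets_pair_measure_cong[OF events_eq_borel events_eq_borel]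
    by simp
  then show ?thesis
    unfolding iid_pair_def PP.indep_var_distribution_eq 1 2 by (auto intro: PP.prob_space_axioms)
qed

section \<open>Sharpness of the constant\<close>

text \<open>For the law of \<open>x\<close> at a uniformly random index, pair probabilities become
  counts of ordered index pairs; counting indices rather than values accounts for
  multiplicities.\<close>

lemma measure_pair_distr_pmf_of_set:
  fixes x :: "'i \<Rightarrow> real" and D :: "real \<Rightarrow> real \<Rightarrow> bool"
  assumes "finite I" "I \<noteq> {}" and D: "{z. D (fst z) (snd z)} \<in> sets (borel :: (real \<times> real) measure)"
  defines "\<mu> \<equiv> distr (measure_pmf (pmf_of_set I)) borel x"
  shows "measure (\<mu> \<Otimes>\<^sub>M \<mu>) {z. D (fst z) (snd z)}
    = real (\<Sum>i\<in>I. card {j\<in>I. D (x i) (x j)}) / (real (card I))\<^sup>2"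
proof -
  interpret real_distribution \<mu>
    unfolding \<mu>_def by (rule prob_space.real_distribution_distr) (auto intro: prob_space_measure_pmf)
  have [measurable]: "{y. D z y} \<in> sets borel" for z
  proof -
    have "(\<lambda>y. (z, y)) -` {z. D (fst z) (snd z)} \<inter> space borel \<in> sets borel"
      by (rule measurable_sets[OF _ D]) (simp add: borel_prod[symmetric])
    then show ?thesis by (simp add: vimage_def)
  qed
  have slice: "prob {y. D z y} = real (card {j\<in>I. D z (x j)}) / real (card I)" for z
    unfolding \<mu>_def using assms(1,2)
    by (subst measure_distr) (auto simp: measure_pmf_of_set vimage_def Int_def)
  note int = measure_pair_eq_integral[of D, OF D]
  define p where "p z = prob {y. D z y}" for z
  have "p \<in> borel_measurable \<mu>"
    using borel_measurable_integrable[OF int(2)] unfolding p_def[abs_def] .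
  then have [measurable]: "p \<in> borel_measurable borel"
    by (simp only: measurable_cong_sets[OF events_eq_borel refl])
  have "(\<integral>z. p z \<partial>\<mu>) = (\<integral>i. p (x i) \<partial>measure_pmf (pmf_of_set I))"
    unfolding \<mu>_def by (rule integral_distr) auto
  also have "\<dots> = real (\<Sum>i\<in>I. card {j\<in>I. D (x i) (x j)}) / (real (card I))\<^sup>2"
    using assms(1,2) by (simp add: integral_pmf_of_set p_def slice sum_divide_distrib power2_eq_square)
  finally show ?thesis using int(1) by (simp add: p_def)
qed

text \<open>Extremal laws are uniform on long arithmetic progressions \<open>d j - (n - 1) d / 4\<close>: the step
  \<open>d > a\<close> leaves only the diagonal differences, and the offset centres a window of \<open>n\<close>
  consecutive sums at the origin.\<close>

lemma constant_sharp:
  fixes a b c :: real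
  assumes "0 < a" "0 < b" "c < real_of_int \<lceil>2 * b / a\<rceil>"
  shows "\<exists>(M :: (real \<times> real) measure) X Y. iid_pair M X Y \<and>
    \<P>(\<omega> in M. \<bar>X \<omega> + Y \<omega>\<bar> \<le> b) > c * \<P>(\<omega> in M. \<bar>X \<omega> - Y \<omega>\<bar> \<le> a)"
proof -
  define n where "n = \<lceil>2 * b / a\<rceil>"
  have "0 < n" unfolding n_def using assms by simp
  have n_less: "(of_int n - 1) * a < 2 * b"
    using ceiling_correct[of "2 * b / a"] assms unfolding n_def by (simp add: pos_less_divide_eq)
  \<comment> \<open>For \<open>n = 1\<close> the second condition is void and any step above
    \<open>a\<close> works. Otherwise the largest admissible step \<open>2 b / (n - 1)\<close>
    exceeds \<open>a\<close>, because \<open>n - 1 < 2 b / a\<close> for the ceiling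
    \<open>n\<close>.\<close>
  obtain d where d: "a < d" "(of_int n - 1) * d \<le> 2 * b"
  proof (cases "n = 1")
    case True
    then show ?thesis using that[of "a + 1"] assms by simp
  next
    case False
    then have "0 < (of_int n - 1 :: real)" using \<open>0 < n\<close> by simp
    then show ?thesis using that[of "2 * b / (of_int n - 1)"] n_less by (simp add: field_simps)
  qed
  \<comment> \<open>The target \<open>c (2 L + 1) < n (2 L + 2 - n)\<close> is equivalent to
    \<open>n (n - 1) < (2 L + 1) (n - c)\<close>, which holds for large \<open>L\<close> since
    \<open>c < n\<close>.\<close>
  obtain L0 :: nat where L0: "of_int n * (of_int n - 1) / (of_int n - c) < real L0"
    using reals_Archimedean2 by blast
  define L where "L = max (int L0) n"
  have "0 < of_int n - c" using assms by (simp add: n_def)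
  then have "of_int n * (of_int n - 1) < real L0 * (of_int n - c)"
    using L0 by (simp add: pos_divide_less_eq)
  also have "\<dots> \<le> (2 * of_int L + 1) * (of_int n - c)"
    using \<open>0 < of_int n - c\<close> \<open>0 < n\<close> by (intro mult_right_mono) (auto simp: L_def max_def)
  finally have L: "c * (2 * of_int L + 1) < of_int n * (2 * of_int L + 2 - of_int n)"
    by (simp add: algebra_simps)
  have "n \<le> L" by (simp add: L_def)
  define x where "x j = d * of_int j - (of_int n - 1) * d / 4" for j
  define \<mu> where "\<mu> = distr (measure_pmf (pmf_of_set {- L..L})) borel x"
  interpret real_distribution \<mu>
    unfolding \<mu>_def by (rule prob_space.real_distribution_distr) (auto intro: prob_space_measure_pmf)
  have bS: "{z::real \<times> real. \<bar>fst z + snd z\<bar> \<le> b} \<in> sets borel"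
    and bT: "{z::real \<times> real. \<bar>fst z - snd z\<bar> \<le> a} \<in> sets borel"
    by (intro borel_closed closed_Collect_le continuous_intros)+
  have fin: "finite {- L..L}" "{- L..L} \<noteq> {}" and card: "real (card {- L..L}) = 2 * of_int L + 1"
    using \<open>n \<le> L\<close> \<open>0 < n\<close> by auto
  have pos: "0 < (2 * of_int L + 1 :: real)" using \<open>n \<le> L\<close> \<open>0 < n\<close> by linarith
  have T: "measure (\<mu> \<Otimes>\<^sub>M \<mu>) {z. \<bar>fst z - snd z\<bar> \<le> a} = 1 / (2 * of_int L + 1)"
  proof -
    have "{j\<in>{- L..L}. \<bar>x i - x j\<bar> \<le> a} = {i}" if "i \<in> {- L..L}" for i
    proof -
      have "j = i" if "\<bar>x i - x j\<bar> \<le> a" for j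
      proof (rule ccontr)
        assume "j \<noteq> i"
        then have "d * 1 \<le> d * \<bar>of_int (i - j)\<bar>"
          using d assms(1) by (intro mult_left_mono) linarith+
        also have "\<dots> = \<bar>x i - x j\<bar>"
          using d assms(1) by (simp add: x_def abs_mult flip: right_diff_distrib)
        finally show False using that d(1) by simp
      qed
      then show ?thesis using that assms(1) by auto
    qed
    then have "(\<Sum>i\<in>{- L..L}. card {j\<in>{- L..L}. \<bar>x i - x j\<bar> \<le> a}) = card {- L..L}"
      by simp
    then show ?thesis
      unfolding \<mu>_def using measure_pair_distr_pmf_of_set[OF fin bT, of x] card pos
      by (simp only: power2_eq_square) simp
  qed
  have S: "of_int n * (2 * of_int L + 2 - of_int n) / (2 * of_int L + 1)\<^sup>2
      \<le> measure (\<mu> \<Otimes>\<^sub>M \<mu>) {z. \<bar>fst z + snd z\<bar> \<le> b}"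
  proof -
    \<comment> \<open>The two offsets add up to \<open>(n - 1) d / 2\<close>, so these sums range
      over an interval symmetric about 0 with radius \<open>(n - 1) d / 2 \<le> b\<close>.\<close>
    have close: "\<bar>x i + x j\<bar> \<le> b" if "0 \<le> i + j" "i + j \<le> n - 1" for i j
    proof -
      have "d * 0 \<le> d * of_int (i + j)" "d * of_int (i + j) \<le> d * of_int (n - 1)"
        using that d(1) assms(1) by (intro mult_left_mono; simp)+
      then have "0 \<le> d * of_int (i + j)" "d * of_int (i + j) \<le> (of_int n - 1) * d"
        by (simp_all add: mult.commute)
      moreover have "x i + x j = d * of_int (i + j) - (of_int n - 1) * d / 2"
        by (simp add: x_def field_simps)
      ultimately show ?thesis using d(2) by linarith
    qed
    \<comment> \<open>For these \<open>2 L + 2 - n\<close> values of \<open>i\<close>, all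
      \<open>n\<close> partners \<open>j\<close> from \<open>- i\<close> to \<open>n - 1 - i\<close>
      stay within the progression; the indices near its lower end are dropped.\<close>
    have "nat n \<le> card {j\<in>{- L..L}. \<bar>x i + x j\<bar> \<le> b}" if "i \<in> {n - 1 - L..L}" for i
    proof -
      have "card {- i..n - 1 - i} \<le> card {j\<in>{- L..L}. \<bar>x i + x j\<bar> \<le> b}"
      proof (rule card_mono)
        show "finite {j\<in>{- L..L}. \<bar>x i + x j\<bar> \<le> b}"
          by (rule finite_subset[of _ "{- L..L}"]) auto
        show "{- i..n - 1 - i} \<subseteq> {j\<in>{- L..L}. \<bar>x i + x j\<bar> \<le> b}"
          using that close[of i] by auto
      qed
      then show ?thesis by simp
    qed
    then have "(\<Sum>i\<in>{n - 1 - L..L}. nat n) \<le> (\<Sum>i\<in>{n - 1 - L..L}. card {j\<in>{- L..L}. \<bar>x i + x j\<bar> \<le> b})"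
      by (rule sum_mono)
    also have "\<dots> \<le> (\<Sum>i\<in>{- L..L}. card {j\<in>{- L..L}. \<bar>x i + x j\<bar> \<le> b})"
      using \<open>0 < n\<close> by (intro sum_mono2) auto
    finally have "real (nat (2 * L + 2 - n) * nat n) \<le> real (\<Sum>i\<in>{- L..L}. card {j\<in>{- L..L}. \<bar>x i + x j\<bar> \<le> b})"
      by (simp only: of_nat_le_iff) (simp add: algebra_simps)
    then have "of_int n * (2 * of_int L + 2 - of_int n)
        \<le> real (\<Sum>i\<in>{- L..L}. card {j\<in>{- L..L}. \<bar>x i + x j\<bar> \<le> b})"
      using \<open>n \<le> L\<close> \<open>0 < n\<close> by (simp only: of_nat_mult) (simp add: mult.commute)
    then show ?thesis
      unfolding \<mu>_def measure_pair_distr_pmf_of_set[OF fin bS] card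
      by (intro divide_right_mono) auto
  qed
  have "c * (1 / (2 * of_int L + 1)) = c * (2 * of_int L + 1) / (2 * of_int L + 1)\<^sup>2"
    using pos by (simp add: power2_eq_square)
  also have "\<dots> < of_int n * (2 * of_int L + 2 - of_int n) / (2 * of_int L + 1)\<^sup>2"
    using L pos by (intro divide_strict_right_mono) auto
  also note S
  finally have "c * measure (\<mu> \<Otimes>\<^sub>M \<mu>) {z. \<bar>fst z - snd z\<bar> \<le> a}
      < measure (\<mu> \<Otimes>\<^sub>M \<mu>) {z. \<bar>fst z + snd z\<bar> \<le> b}"
    by (simp only: T)
  then show ?thesis
    using iid_pair_fst_snd by (intro exI[of _ "\<mu> \<Otimes>\<^sub>M \<mu>"] exI[of _ fst] exI[of _ snd]) (simp add: space_pair_measure)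
qed

section \<open>Conclusion for random variables\<close>

lemma prob_sum_le_of_iid_pair:
  fixes a b :: real
  assumes "iid_pair M X Y" "0 < a" "0 < b"
  shows "\<P>(\<omega> in M. \<bar>X \<omega> + Y \<omega>\<bar> \<le> b)
      \<le> real_of_int \<lceil>2 * b / a\<rceil> * \<P>(\<omega> in M. \<bar>X \<omega> - Y \<omega>\<bar> \<le> a)" (is ?weak)
    and "a / 2 < b \<Longrightarrow> \<P>(\<omega> in M. \<bar>X \<omega> + Y \<omega>\<bar> \<le> b)
      < real_of_int \<lceil>2 * b / a\<rceil> * \<P>(\<omega> in M. \<bar>X \<omega> - Y \<omega>\<bar> \<le> a)" (is "_ \<Longrightarrow> ?strict")
proof -
  interpret real_distribution "distr M borel X"
    by (rule real_distribution_distr_iid_pair) fact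
  define n where "n = nat \<lceil>2 * b / a\<rceil>"
  have "0 < 2 * b / a" using assms by simp
  then have n: "real_of_int \<lceil>2 * b / a\<rceil> = real n" and "0 < n"
    by (auto simp: n_def)
  have "2 * b / a \<le> real n" unfolding n[symmetric] by simp
  then have nb: "2 * b \<le> real n * a" using assms by (simp add: field_simps)
  have bS: "{z::real \<times> real. \<bar>fst z + snd z\<bar> \<le> r} \<in> sets borel"
    and bT: "{z::real \<times> real. \<bar>fst z - snd z\<bar> \<le> r} \<in> sets borel" for r
    by (intro borel_closed closed_Collect_le continuous_intros)+
  note S = prob_iid_pair[where D = "\<lambda>x y. \<bar>x + y\<bar> \<le> r" for r, OF assms(1) bS]
    and T = prob_iid_pair[where D = "\<lambda>x y. \<bar>x - y\<bar> \<le> r" for r, OF assms(1) bT]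
  show ?weak
    unfolding n S T using assms \<open>0 < n\<close> nb by (intro weak_inequality)
  show ?strict if "a / 2 < b"
  proof -
    \<comment> \<open>The hypothesis \<open>a / 2 < b\<close> enters here: it forces
      \<open>n \<ge> 2\<close>, as the strict inequality requires.\<close>
    have "1 < 2 * b / a" using that assms by (simp add: field_simps)
    then have "2 \<le> n" unfolding n_def by linarith
    interpret PP: pair_prob_space "distr M borel X" "distr M borel X" by unfold_locales
    have sets: "sets (distr M borel X \<Otimes>\<^sub>M distr M borel X) = sets borel"
      using sets_pair_measure_cong[OF events_eq_borel events_eq_borel] by (simp only: borel_prod)
    have "measure (distr M borel X \<Otimes>\<^sub>M distr M borel X) {z. \<bar>fst z + snd z\<bar> \<le> b}
      \<le> measure (distr M borel X \<Otimes>\<^sub>M distr M borel X) {z. \<bar>fst z + snd z\<bar> \<le> real n * a / 2}"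
    proof (rule PP.finite_measure_mono)
      show "{z::real \<times> real. \<bar>fst z + snd z\<bar> \<le> b} \<subseteq> {z. \<bar>fst z + snd z\<bar> \<le> real n * a / 2}"
        using nb by auto
    qed (simp only: bS sets)
    also note strict_inequality[OF assms(2) \<open>2 \<le> n\<close>]
    finally show ?thesis unfolding n S T .
  qed
qed

theorem theorem2:
  fixes a b :: real
  shows
    "(0 < a / 2 \<and> a / 2 < b \<longrightarrow>
        (\<forall>(M :: 'w measure) X Y. iid_pair M X Y \<longrightarrow>
           \<P>(\<omega> in M. \<bar>X \<omega> + Y \<omega>\<bar> \<le> b)
             < real_of_int \<lceil>2 * b / a\<rceil> * \<P>(\<omega> in M. \<bar>X \<omega> - Y \<omega>\<bar> \<le> a)) \<and>
        (\<forall>c :: real. c < real_of_int \<lceil>2 * b / a\<rceil> \<longrightarrow>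
           (\<exists>(M :: (real \<times> real) measure) X Y. iid_pair M X Y \<and>
              \<P>(\<omega> in M. \<bar>X \<omega> + Y \<omega>\<bar> \<le> b) > c * \<P>(\<omega> in M. \<bar>X \<omega> - Y \<omega>\<bar> \<le> a))))
     \<and>
     (0 < b \<and> b \<le> a / 2 \<longrightarrow>
        \<lceil>2 * b / a\<rceil> = 1 \<and>
        (\<forall>(M :: 'w measure) X Y. iid_pair M X Y \<longrightarrow>
           \<P>(\<omega> in M. \<bar>X \<omega> + Y \<omega>\<bar> \<le> b)
             \<le> real_of_int \<lceil>2 * b / a\<rceil> * \<P>(\<omega> in M. \<bar>X \<omega> - Y \<omega>\<bar> \<le> a)) \<and>
        (\<forall>c :: real. c < real_of_int \<lceil>2 * b / a\<rceil> \<longrightarrow>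
           (\<exists>(M :: (real \<times> real) measure) X Y. iid_pair M X Y \<and>
              \<P>(\<omega> in M. \<bar>X \<omega> + Y \<omega>\<bar> \<le> b) > c * \<P>(\<omega> in M. \<bar>X \<omega> - Y \<omega>\<bar> \<le> a))))"
proof (intro conjI impI allI)
  fix M :: "'w measure" and X Y
  assume ab: "0 < a / 2 \<and> a / 2 < b" and iid: "iid_pair M X Y"
  show "\<P>(\<omega> in M. \<bar>X \<omega> + Y \<omega>\<bar> \<le> b)
      < real_of_int \<lceil>2 * b / a\<rceil> * \<P>(\<omega> in M. \<bar>X \<omega> - Y \<omega>\<bar> \<le> a)"
    by (rule prob_sum_le_of_iid_pair(2)[OF iid]) (use ab in linarith)+
next
  fix c :: real
  assume ab: "0 < a / 2 \<and> a / 2 < b" and c: "c < real_of_int \<lceil>2 * b / a\<rceil>"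
  show "\<exists>(M :: (real \<times> real) measure) X Y. iid_pair M X Y \<and>
      \<P>(\<omega> in M. \<bar>X \<omega> + Y \<omega>\<bar> \<le> b) > c * \<P>(\<omega> in M. \<bar>X \<omega> - Y \<omega>\<bar> \<le> a)"
    by (rule constant_sharp[OF _ _ c]) (use ab in linarith)+
next
  assume "0 < b \<and> b \<le> a / 2"
  then show "\<lceil>2 * b / a\<rceil> = 1"
    by (simp add: ceiling_eq_iff field_simps)
next
  fix M :: "'w measure" and X Y
  assume ab: "0 < b \<and> b \<le> a / 2" and iid: "iid_pair M X Y"
  show "\<P>(\<omega> in M. \<bar>X \<omega> + Y \<omega>\<bar> \<le> b)
      \<le> real_of_int \<lceil>2 * b / a\<rceil> * \<P>(\<omega> in M. \<bar>X \<omega> - Y \<omega>\<bar> \<le> a)"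
    by (rule prob_sum_le_of_iid_pair(1)[OF iid]) (use ab in linarith)+
next
  fix c :: real
  assume ab: "0 < b \<and> b \<le> a / 2" and c: "c < real_of_int \<lceil>2 * b / a\<rceil>"
  show "\<exists>(M :: (real \<times> real) measure) X Y. iid_pair M X Y \<and>
      \<P>(\<omega> in M. \<bar>X \<omega> + Y \<omega>\<bar> \<le> b) > c * \<P>(\<omega> in M. \<bar>X \<omega> - Y \<omega>\<bar> \<le> a)"
    by (rule constant_sharp[OF _ _ c]) (use ab in linarith)+
qed

end
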